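(* Let $\varphi=(1+\sqrt5)/2$ and let $\mathbb{O}$ be the real (division) algebra of octonions. There is no $\mathbb{Z}[\varphi]$-order $\mathcal{G}_3\subset\mathbb{O}$ whose unit shell $\mathcal{S}_1(\mathcal{G}_3)=\{x\in\mathcal{G}_3:N(x)=1\}$ is an indecomposable non-crystallographic root-shell system over $\mathbb{Z}[\varphi]$ and has full $\mathbb{R}$-rank $8$ (that is, $\dim_{\mathbb{R}}\operatorname{span}_{\mathbb{R}}\mathcal{S}_1(\mathcal{G}_3)=8$).
   Context: $\mathbb{O}$ carries its standard positive definite multiplicative norm $N$, polar form $B(x,y)=N(x+y)-N(x)-N(y)=x\bar y+y\bar x$, conjugation $\bar x=B(x,1)\cdot1-x$, and is viewed as Euclidean $\mathbb{R}^8$ with $\langle x,y\rangle=\tfrac12B(x,y)$. A $\mathbb{Z}[\varphi]$-order in $\mathbb{O}$ is a finitely generated $\mathbb{Z}[\varphi]$-submodule $\mathcal{O}'\subset\mathbb{O}$ with $1\in\mathcal{O}'$, $\overline{\mathcal{O}'}=\mathcal{O}'$, $\mathcal{O}'\cdot\mathcal{O}'\subseteq\mathcal{O}'$, $N(\mathcal{O}')\subseteq\mathbb{Z}[\varphi]$, and $B$ restricting to a $\mathbb{Z}[\varphi]$-bilinear map $\mathcal{O}'\times\mathcal{O}'\to\mathbb{Z}[\varphi]$. A root-shell system over $\mathbb{Z}[\varphi]$ is a finite subset $T$ of a Euclidean space $V$ such that (R1) $T=-T$; (R2) $T$ is contained in a single sphere $\{x\in V: \mathcal N(x)=1\}$ for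 the Euclidean (squared) norm $\mathcal N$, so all elements of $T$ have the same length; (R3) for every $\alpha\in T$ the reflection $r_\alpha(x)=x-\frac{2\langle x,\alpha\rangle}{\langle\alpha,\alpha\rangle}\alpha$ preserves $T$; (R4) the Cartan coefficients $\frac{2\langle\alpha,\beta\rangle}{\langle\alpha,\alpha\rangle}$ lie in $\mathbb{Z}[\varphi]$ for all $\alpha,\beta\in T$. It is non-crystallographic if some Cartan coefficient is not in $\mathbb{Z}$, and indecomposable if it is not the union of two nonempty mutually orthogonal subsets. *)

theory Defs
  imports "HOL-Analysis.Analysis"
begin

text \<open>
  Octonions by Cayley--Dickson doubling, starting from the complex numbers with
  \<open>(a, b) (c, d) = (a c - d\<^sup>* b, d a + b c\<^sup>*)\<close>.
  On the nested product type the inner product of the library is the standard one of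
  Euclidean 8-space, so \<open>inner\<close>, \<open>span\<close>, \<open>dim\<close>, \<open>orthogonal\<close> apply directly.
\<close>

type_synonym quaternion = "complex \<times> complex"
type_synonym octonion = "quaternion \<times> quaternion"

definition quat_cnj :: "quaternion \<Rightarrow> quaternion" where
  "quat_cnj p = (cnj (fst p), - snd p)"

definition quat_mult :: "quaternion \<Rightarrow> quaternion \<Rightarrow> quaternion" where
  "quat_mult p q =
     (fst p * fst q - cnj (snd q) * snd p, snd q * fst p + snd p * cnj (fst q))"

definition oct_mult :: "octonion \<Rightarrow> octonion \<Rightarrow> octonion" (infixl "\<bullet>\<^sub>O" 70) where
  "x \<bullet>\<^sub>O y =
     (quat_mult (fst x) (fst y) - quat_mult (quat_cnj (snd y)) (snd x),
      quat_mult (snd y) (fst x) + quat_mult (snd x) (quat_cnj (fst y)))"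

definition oct_one :: octonion where
  "oct_one = ((1, 0), (0, 0))"

definition oct_N :: "octonion \<Rightarrow> real" where
  "oct_N x = inner x x"

definition oct_B :: "octonion \<Rightarrow> octonion \<Rightarrow> real" where
  "oct_B x y = oct_N (x + y) - oct_N x - oct_N y"

definition oct_cnj :: "octonion \<Rightarrow> octonion" where
  "oct_cnj x = oct_B x oct_one *\<^sub>R oct_one - x"

lemma inner_eq_half_oct_B: "inner x y = oct_B x y / 2"
  by (simp add: oct_B_def oct_N_def inner_add_left inner_add_right inner_commute)

lemma oct_cnj_eq: "oct_cnj x = (quat_cnj (fst x), - snd x)"
  by (auto simp: oct_cnj_def inner_eq_half_oct_B[symmetric] oct_one_def quat_cnj_def
      oct_B_def oct_N_def inner_prod_def inner_complex_def prod_eq_iff complex_eq_iff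
      power2_eq_square algebra_simps)

lemma oct_mult_one_left: "oct_one \<bullet>\<^sub>O x = x"
  and oct_mult_one_right: "x \<bullet>\<^sub>O oct_one = x"
  by (simp_all add: oct_mult_def oct_one_def quat_mult_def quat_cnj_def prod_eq_iff)

lemma oct_N_mult: "oct_N (x \<bullet>\<^sub>O y) = oct_N x * oct_N y"
  by (simp add: oct_N_def oct_mult_def quat_mult_def quat_cnj_def inner_prod_def
      inner_complex_def) algebra

lemma oct_B_eq_trace:
  "x \<bullet>\<^sub>O oct_cnj y + y \<bullet>\<^sub>O oct_cnj x = oct_B x y *\<^sub>R oct_one"
  by (simp add: oct_cnj_eq oct_mult_def oct_one_def quat_mult_def quat_cnj_def oct_B_def
      oct_N_def inner_prod_def inner_complex_def prod_eq_iff complex_eq_iff algebra_simps)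

definition golden :: real ("\<phi>") where
  "\<phi> = (1 + sqrt 5) / 2"

definition Zphi :: "real set" where
  "Zphi = {of_int a + of_int b * \<phi> | a b :: int. True}"

definition Zphi_submodule :: "'a::real_vector set \<Rightarrow> bool" where
  "Zphi_submodule M \<longleftrightarrow>
     0 \<in> M \<and> (\<forall>x\<in>M. \<forall>y\<in>M. x + y \<in> M) \<and> (\<forall>c\<in>Zphi. \<forall>x\<in>M. c *\<^sub>R x \<in> M)"

definition Zphi_fin_gen :: "'a::real_vector set \<Rightarrow> bool" where
  "Zphi_fin_gen M \<longleftrightarrow> (\<exists>S. finite S \<and> M = Zphi_submodule hull S)"

definition Zphi_bilinear_on :: "'a::real_vector set \<Rightarrow> ('a \<Rightarrow> 'a \<Rightarrow> real) \<Rightarrow> bool" where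
  "Zphi_bilinear_on M b \<longleftrightarrow>
     (\<forall>x\<in>M. \<forall>y\<in>M. b x y \<in> Zphi) \<and>
     (\<forall>x\<in>M. \<forall>y\<in>M. \<forall>z\<in>M. b (x + y) z = b x z + b y z \<and> b z (x + y) = b z x + b z y) \<and>
     (\<forall>c\<in>Zphi. \<forall>x\<in>M. \<forall>y\<in>M. b (c *\<^sub>R x) y = c * b x y \<and> b x (c *\<^sub>R y) = c * b x y)"

definition Zphi_order :: "octonion set \<Rightarrow> bool" where
  "Zphi_order G \<longleftrightarrow>
     Zphi_submodule G \<and> Zphi_fin_gen G \<and>
     oct_one \<in> G \<and> oct_cnj ` G = G \<and> (\<forall>x\<in>G. \<forall>y\<in>G. x \<bullet>\<^sub>O y \<in> G) \<and>
     oct_N ` G \<subseteq> Zphi \<and> Zphi_bilinear_on G oct_B"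

definition unit_shell :: "octonion set \<Rightarrow> octonion set" where
  "unit_shell G = {x \<in> G. oct_N x = 1}"

definition cartan_coeff :: "'a::euclidean_space \<Rightarrow> 'a \<Rightarrow> real" where
  "cartan_coeff \<alpha> \<beta> = 2 * inner \<alpha> \<beta> / inner \<alpha> \<alpha>"

definition root_reflection :: "'a::euclidean_space \<Rightarrow> 'a \<Rightarrow> 'a" where
  "root_reflection \<alpha> x = x - (2 * inner x \<alpha> / inner \<alpha> \<alpha>) *\<^sub>R \<alpha>"

definition root_shell_system :: "'a::euclidean_space set \<Rightarrow> bool" where
  "root_shell_system T \<longleftrightarrow>
     finite T \<and>
     T = uminus ` T \<and>
     T \<subseteq> {x. inner x x = 1} \<and>
     (\<forall>\<alpha>\<in>T. root_reflection \<alpha> ` T = T) \<and>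
     (\<forall>\<alpha>\<in>T. \<forall>\<beta>\<in>T. cartan_coeff \<alpha> \<beta> \<in> Zphi)"

definition non_crystallographic :: "'a::euclidean_space set \<Rightarrow> bool" where
  "non_crystallographic T \<longleftrightarrow> (\<exists>\<alpha>\<in>T. \<exists>\<beta>\<in>T. cartan_coeff \<alpha> \<beta> \<notin> \<int>)"

definition indecomposable :: "'a::euclidean_space set \<Rightarrow> bool" where
  "indecomposable T \<longleftrightarrow>
     \<not> (\<exists>A B. A \<noteq> {} \<and> B \<noteq> {} \<and> T = A \<union> B \<and> (\<forall>a\<in>A. \<forall>b\<in>B. orthogonal a b))"

end

theory Submission
  imports Defs
begin

text \<open>
  Let \<open>U\<close> be the unit shell. It is closed under multiplication, conjugation and negation, and
  \<open>2 \<langle>u, v\<rangle>\<close> is the trace of the unit \<open>u v\<^sup>*\<close>. The trace satisfies \<open>tr (u\<^sup>2) = (tr u)\<^sup>2 - 2\<close>, and so does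
  its Galois conjugate; since \<open>U\<close> is finite, the conjugate traces are therefore bounded by 2 as
  well. An element of \<open>\<int>[\<phi>]\<close> that lies in \<open>[-2, 2]\<close> together with its conjugate is one of
  \<open>0, \<plusminus>1, \<plusminus>2, \<plusminus>\<phi>, \<plusminus>(\<phi> - 1)\<close>, so these are the only Cartan coefficients
  (\<open>double_inner_values\<close>).

  A non-integral coefficient produces a unit \<open>x\<close> of trace \<open>\<phi>\<close>, of order ten. By indecomposability
  and rank, some unit is neither in the plane \<open>span {1, x}\<close> nor orthogonal to it, and multiplying it
  by powers of \<open>x\<close> makes its trace vanish (\<open>perpendicular_unit_exists\<close>). From this unit and \<open>x\<close>
  arises an orthonormal frame \<open>1, i, j, ij\<close> inside \<open>U\<close> with \<open>2 x = \<phi> + i + (\<phi> - 1) j\<close>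
  (\<open>icosian_frame_exists\<close>). The order then contains the icosian ring on this frame, the
  \<open>\<int>[\<phi>]\<close>-lattice of the root system \<open>H\<^sub>4\<close>.

  That lattice is unimodular for \<open>2 \<langle>\<cdot>, \<cdot>\<rangle>\<close>, so the orthogonal projection \<open>v\<close> of any unit \<open>\<alpha>\<close> to the
  quaternion space \<open>span {1, i, j, ij}\<close> is an icosian, and its norm lies in \<open>\<int>[\<phi>]\<close>. The norm is a
  quarter of the sum of four squared Cartan coefficients, and this leaves only \<open>0\<close> and \<open>2 - \<phi>\<close>
  below 1 (\<open>sum_four_trace_squares\<close>). The value \<open>2 - \<phi>\<close> is impossible: \<open>\<phi> v\<close> would be a unit whose
  Cartan coefficient with \<open>\<alpha>\<close> is \<open>2 (\<phi> - 1)\<close>, which is not on the list. So every unit lies in the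
  quaternion space or is orthogonal to it (\<open>icosian_dichotomy\<close>), and an indecomposable shell is
  stuck in dimension four.\<close>

section \<open>The ring of golden integers and its conjugation\<close>

lemma golden_sq: "\<phi> * \<phi> = \<phi> + 1"
  by (simp add: golden_def field_simps)

lemma golden_minus_one_sq:
  "(\<phi> - 1) * (\<phi> - 1) = 2 - \<phi>" "(1 - \<phi>) * (1 - \<phi>) = 2 - \<phi>"
  using golden_sq by (simp_all add: algebra_simps)

text \<open>The unit \<open>2 - \<phi>\<close> is \<open>(\<phi> - 1)\<^sup>2 = \<phi>\<^sup>-\<^sup>2\<close>, so multiplying by \<open>\<phi>\<close> turns norm \<open>2 - \<phi>\<close> into norm 1.\<close>

lemma golden_sq_inverse: "\<phi> * (\<phi> * (2 - \<phi>)) = 1"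
  using golden_sq by algebra

lemma golden_bounds: "1618 / 1000 < \<phi>" "\<phi> < 1619 / 1000"
proof -
  have "2236 / 1000 < sqrt 5" by (rule real_less_rsqrt) (simp add: power2_eq_square)
  moreover have "sqrt 5 < 2238 / 1000" by (rule real_less_lsqrt) (simp_all add: power2_eq_square)
  ultimately show "1618 / 1000 < \<phi>" "\<phi> < 1619 / 1000" by (simp_all add: golden_def)
qed

text \<open>Infinite descent at the prime 5: this is the irrationality of \<open>sqrt 5\<close>.\<close>

lemma square_eq_five_times_square:
  fixes u v :: int
  assumes "u * u = 5 * (v * v)"
  shows "v = 0"
  using assms
proof (induction "nat \<bar>v\<bar>" arbitrary: u v rule: less_induct)
  case less
  have p5: "prime (5::int)" by simp
  have "5 dvd u" using less.prems p5 prime_dvd_mult_iff dvd_triv_left by metis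
  then obtain u' where u': "u = 5 * u'" by blast
  have e: "v * v = 5 * (u' * u')" using less.prems u' by simp
  then have "5 dvd v" using p5 prime_dvd_mult_iff dvd_triv_left by metis
  then obtain v' where v': "v = 5 * v'" by blast
  have e': "u' * u' = 5 * (v' * v')" using e v' by simp
  show "v = 0"
  proof (rule ccontr)
    assume "v \<noteq> 0"
    then have "nat \<bar>v'\<bar> < nat \<bar>v\<bar>" using v' by auto
    then have "v' = 0" using less.hyps e' by blast
    then show False using v' \<open>v \<noteq> 0\<close> by simp
  qed
qed

lemma Zphi_rep_unique:
  fixes a b a' b' :: int
  assumes "of_int a + of_int b * \<phi> = of_int a' + of_int b' * \<phi>"
  shows "a = a'" "b = b'"
proof -
  define m n where "m = a' - a" and "n = b - b'"
  have "of_int n * \<phi> = of_int m" using assms by (simp add: m_def n_def algebra_simps)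
  then have "of_int n * sqrt 5 = of_int (2 * m - n)" by (simp add: golden_def field_simps)
  then have "(of_int n * sqrt 5) * (of_int n * sqrt 5) = (of_int (2 * m - n) :: real) * of_int (2 * m - n)"
    by simp
  also have "(of_int n * sqrt 5) * (of_int n * sqrt 5) = (of_int (5 * (n * n)) :: real)"
    by (simp add: algebra_simps)
  finally have "5 * (n * n) = (2 * m - n) * (2 * m - n)"
    unfolding of_int_mult[symmetric] of_int_eq_iff .
  then have "n = 0" using square_eq_five_times_square by metis
  then show "b = b'" by (simp add: n_def)
  then show "a = a'" using assms by simp
qed

lemma Zphi_closed:
  "\<phi> \<in> Zphi" "of_int n \<in> Zphi"
  "a \<in> Zphi \<Longrightarrow> - a \<in> Zphi"
  "a \<in> Zphi \<Longrightarrow> b \<in> Zphi \<Longrightarrow> a * b \<in> Zphi"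
proof -
  have "\<phi> = of_int 0 + of_int 1 * \<phi>" by simp
  then show "\<phi> \<in> Zphi" unfolding Zphi_def by blast
  have "of_int n = of_int n + of_int 0 * \<phi>" by simp
  then show "of_int n \<in> Zphi" unfolding Zphi_def by blast
  show "a \<in> Zphi \<Longrightarrow> - a \<in> Zphi" unfolding Zphi_def
  proof clarify
    fix a b
    show "\<exists>e f. - (real_of_int a + of_int b * \<phi>) = of_int e + of_int f * \<phi> \<and> True"
      by (rule exI[of _ "- a"], rule exI[of _ "- b"]) (simp add: algebra_simps)
  qed
  show "a \<in> Zphi \<Longrightarrow> b \<in> Zphi \<Longrightarrow> a * b \<in> Zphi" unfolding Zphi_def
  proof clarify
    fix a b c d
    have "(real_of_int a + of_int b * \<phi>) * (of_int c + of_int d * \<phi>)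
       = of_int (a * c + b * d) + of_int (a * d + b * c + b * d) * \<phi>"
      using golden_sq by simp algebra
    then show "\<exists>e f. (real_of_int a + of_int b * \<phi>) * (of_int c + of_int d * \<phi>) = of_int e + of_int f * \<phi> \<and> True"
      by blast
  qed
qed

text \<open>The nontrivial automorphism of \<open>\<int>[\<phi>]\<close>, sending \<open>\<phi>\<close> to \<open>1 - \<phi>\<close>; outside \<open>\<int>[\<phi>]\<close> its value is
  unspecified.\<close>

definition golden_conj :: "real \<Rightarrow> real" where
  "golden_conj z = (THE w. \<exists>a b :: int. z = of_int a + of_int b * \<phi> \<and> w = of_int a + of_int b * (1 - \<phi>))"

lemma golden_conj_eq: "golden_conj (of_int a + of_int b * \<phi>) = of_int a + of_int b * (1 - \<phi>)"
  unfolding golden_conj_def using Zphi_rep_unique by (intro the_equality) blast+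

text \<open>Conjugation commutes with \<open>t \<mapsto> t\<^sup>2 - 2\<close>, the map by which the trace of a unit changes under
  squaring.\<close>

lemma golden_conj_chebyshev:
  assumes "t \<in> Zphi"
  shows "golden_conj (t * t - 2) = golden_conj t * golden_conj t - 2"
proof -
  obtain a b :: int where t: "t = of_int a + of_int b * \<phi>" using assms unfolding Zphi_def by auto
  have "t * t - 2 = of_int (a * a + b * b - 2) + of_int (2 * a * b + b * b) * \<phi>"
    using golden_sq unfolding t by simp algebra
  then have "golden_conj (t * t - 2) = of_int (a * a + b * b - 2) + of_int (2 * a * b + b * b) * (1 - \<phi>)"
    by (simp only: golden_conj_eq)
  also have "\<dots> = golden_conj t * golden_conj t - 2"
    using golden_sq unfolding t golden_conj_eq by simp algebra
  finally show ?thesis .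
qed

text \<open>The numbers \<open>2 cos (2 \<pi> m / n)\<close> that lie in \<open>\<int>[\<phi>]\<close>: the possible traces of units of finite order.\<close>

abbreviation golden_traces :: "real set" where
  "golden_traces \<equiv> {0, 1, -1, 2, -2, \<phi>, -\<phi>, \<phi> - 1, 1 - \<phi>}"

text \<open>The two embeddings of \<open>a + b \<phi>\<close> differ by \<open>b sqrt 5\<close>, so \<open>\<bar>b\<bar> \<le> 1\<close>; then the bounds leave
  few values of \<open>a\<close>.\<close>

lemma Zphi_totally_bounded:
  assumes "t \<in> Zphi" "\<bar>t\<bar> \<le> 2" "\<bar>golden_conj t\<bar> \<le> 2"
  shows "t \<in> golden_traces"
proof -
  obtain a b :: int where t: "t = of_int a + of_int b * \<phi>" using assms unfolding Zphi_def by auto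
  have 1: "\<bar>of_int a + of_int b * \<phi>\<bar> \<le> 2" "\<bar>of_int a + of_int b * (1 - \<phi>)\<bar> \<le> 2"
    using assms(2,3) unfolding t golden_conj_eq by auto
  have g: "2 < 2 * \<phi> - 1" using golden_bounds by simp
  have "\<bar>of_int b * (2 * \<phi> - 1)\<bar> \<le> 4" using 1 by (simp add: algebra_simps)
  then have 2: "\<bar>of_int b\<bar> * (2 * \<phi> - 1) \<le> 4" using g by (simp add: abs_mult)
  have "\<bar>b\<bar> < 2"
  proof (rule ccontr)
    assume "\<not> \<bar>b\<bar> < 2"
    then have "2 * (2 * \<phi> - 1) \<le> \<bar>of_int b\<bar> * (2 * \<phi> - 1)" using g by (intro mult_right_mono) linarith+
    then have "2 * (2 * \<phi> - 1) \<le> 4" using 2 by (rule order_trans)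
    then show False using g by simp
  qed
  then consider "b = 0" | "b = 1" | "b = -1" by linarith
  then show ?thesis
  proof cases
    case 1
    have "\<bar>a\<bar> \<le> 2" using \<open>\<bar>of_int a + of_int b * \<phi>\<bar> \<le> 2\<close> 1 by simp
    then have "a = 0 \<or> a = 1 \<or> a = -1 \<or> a = 2 \<or> a = -2" by linarith
    then show ?thesis using t 1 by auto
  next
    case 2
    have "- 2 < (of_int a :: real)" "of_int a < (1::real)" using 1 2 golden_bounds by simp_all
    then have "a = 0 \<or> a = -1" by linarith
    then show ?thesis using t 2 by auto
  next
    case 3
    have "- 1 < (of_int a :: real)" "of_int a < (2::real)" using 1 3 golden_bounds by simp_all
    then have "a = 0 \<or> a = 1" by linarith
    then show ?thesis using t 3 by auto
  qed
qed


text \<open>Each square is \<open>m + n \<phi>\<close> with \<open>m \<ge> 0\<close> and \<open>\<bar>n\<bar> \<le> 1\<close>. If a quarter of the sum is \<open>X + Y \<phi>\<close> with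
  integers \<open>X\<close>, \<open>Y\<close>, then \<open>X \<ge> 0\<close> and \<open>\<bar>Y\<bar> \<le> 1\<close>, and the interval \<open>[0, 1)\<close> admits only
  \<open>(X, Y) = (0, 0)\<close> and \<open>(2, -1)\<close>.\<close>

lemma sum_four_trace_squares:
  fixes s :: "nat \<Rightarrow> real"
  assumes s: "\<And>k. k < 4 \<Longrightarrow> s k \<in> golden_traces"
    and Z: "(\<Sum>k<4. s k * s k) / 4 \<in> Zphi" and lt: "(\<Sum>k<4. s k * s k) / 4 < 1"
  shows "(\<Sum>k<4. s k * s k) / 4 = 0 \<or> (\<Sum>k<4. s k * s k) / 4 = 2 - \<phi>"
proof -
  have sq: "\<exists>m n :: int. t * t = of_int m + of_int n * \<phi> \<and> 0 \<le> m \<and> \<bar>n\<bar> \<le> 1"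
    if "t \<in> golden_traces" for t
  proof -
    have "t * t = of_int 0 + of_int 0 * \<phi> \<or> t * t = of_int 1 + of_int 0 * \<phi> \<or> t * t = of_int 4 + of_int 0 * \<phi>
      \<or> t * t = of_int 1 + of_int 1 * \<phi> \<or> t * t = of_int 2 + of_int (- 1) * \<phi>"
      using that golden_sq golden_minus_one_sq by (elim insertE emptyE; simp)
    then show ?thesis by (elim disjE) (rule exI, rule exI, erule conjI, simp)+
  qed
  have ex: "\<forall>k. \<exists>mn :: int \<times> int. k < 4 \<longrightarrow>
      s k * s k = of_int (fst mn) + of_int (snd mn) * \<phi> \<and> 0 \<le> fst mn \<and> \<bar>snd mn\<bar> \<le> 1"
  proof (intro allI)
    fix k
    show "\<exists>mn :: int \<times> int. k < 4 \<longrightarrow>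
      s k * s k = of_int (fst mn) + of_int (snd mn) * \<phi> \<and> 0 \<le> fst mn \<and> \<bar>snd mn\<bar> \<le> 1"
    proof (cases "k < 4")
      case True
      then obtain m n :: int where "s k * s k = of_int m + of_int n * \<phi> \<and> 0 \<le> m \<and> \<bar>n\<bar> \<le> 1"
        using sq[OF s] by blast
      then show ?thesis by (intro exI[of _ "(m, n)"]) simp
    qed simp
  qed
  then obtain mn :: "nat \<Rightarrow> int \<times> int" where "\<forall>k. k < 4 \<longrightarrow>
      s k * s k = of_int (fst (mn k)) + of_int (snd (mn k)) * \<phi> \<and> 0 \<le> fst (mn k) \<and> \<bar>snd (mn k)\<bar> \<le> 1"
    using choice[OF ex] by blast
  then obtain m n :: "nat \<Rightarrow> int" where mn: "\<And>k. k < 4 \<Longrightarrow> s k * s k = of_int (m k) + of_int (n k) * \<phi>"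
    and m0: "\<And>k. k < 4 \<Longrightarrow> 0 \<le> m k" and n1: "\<And>k. k < 4 \<Longrightarrow> \<bar>n k\<bar> \<le> 1"
    using that[of "fst \<circ> mn" "snd \<circ> mn"] by simp
  define N where "N = (\<Sum>k<4. s k * s k) / 4"
  obtain X Y :: int where N: "N = of_int X + of_int Y * \<phi>" using Z unfolding N_def Zphi_def by auto
  have "4 * N = (\<Sum>k<4. of_int (m k) + of_int (n k) * \<phi>)" unfolding N_def using mn by simp
  also have "\<dots> = of_int (\<Sum>k<4. m k) + of_int (\<Sum>k<4. n k) * \<phi>"
    by (simp add: sum.distrib sum_distrib_right)
  finally have "of_int (4 * X) + of_int (4 * Y) * \<phi> = of_int (\<Sum>k<4. m k) + of_int (\<Sum>k<4. n k) * \<phi>"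
    using N by simp
  from Zphi_rep_unique[OF this] have X: "4 * X = (\<Sum>k<4. m k)" and Y: "4 * Y = (\<Sum>k<4. n k)" .
  have X0: "0 \<le> X" using X m0 sum_nonneg[of "{..<4}" m] by simp
  have "\<bar>\<Sum>k<4. n k\<bar> \<le> (\<Sum>k<4. \<bar>n k\<bar>)" by (rule sum_abs)
  also have "\<dots> \<le> 4" using sum_bounded_above[of "{..<4}" "\<lambda>k. \<bar>n k\<bar>" 1] n1 by simp
  finally have "\<bar>Y\<bar> \<le> 1" using Y by linarith
  have N01: "0 \<le> N" "N < 1" using lt unfolding N_def by (simp_all add: sum_nonneg)
  from \<open>\<bar>Y\<bar> \<le> 1\<close> consider "Y = 0" | "Y = 1" | "Y = -1" by linarith
  then show ?thesis unfolding N_def[symmetric]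
  proof cases
    case 1
    then have "X = 0" using N N01 X0 by simp
    then show "N = 0 \<or> N = 2 - \<phi>" using 1 N by simp
  next
    case 2
    then have "N = of_int X + \<phi>" using N by simp
    then have "of_int X < (0::real)" using N01 golden_bounds by linarith
    then show "N = 0 \<or> N = 2 - \<phi>" using X0 by simp
  next
    case 3
    then have e: "N = of_int X - \<phi>" using N by simp
    then have "1 < (of_int X :: real)" "of_int X < (3 :: real)" using N01 golden_bounds by linarith+
    then have "X = 2" by linarith
    then show "N = 0 \<or> N = 2 - \<phi>" using e by simp
  qed
qed

section \<open>Traces along an orbit of order ten\<close>

text \<open>If \<open>x\<close> has trace \<open>\<phi>\<close>, the traces \<open>a\<^sub>k\<close> of \<open>x\<^sup>k z\<close> satisfy \<open>a\<^bsub>k-1\<^esub> + a\<^bsub>k+1\<^esub> = \<phi> a\<^sub>k\<close>. For \<open>a\<^sub>k\<close>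
  equal to 1, \<open>\<phi>\<close>, \<open>\<phi> - 1\<close> the right-hand side is \<open>\<phi>\<close>, \<open>\<phi> + 1\<close>, 1, and each of these is a sum of
  two nonzero traces in only one way.\<close>

lemma neighbours_in_trace_sequence:
  assumes a: "a \<in> {1, -1, \<phi>, -\<phi>, \<phi> - 1, 1 - \<phi>}" and c: "c \<in> {1, -1, \<phi>, -\<phi>, \<phi> - 1, 1 - \<phi>}"
  shows "a + c = \<phi> \<Longrightarrow> a = 1 \<and> c = \<phi> - 1 \<or> a = \<phi> - 1 \<and> c = 1"
    and "a + c = \<phi> + 1 \<Longrightarrow> a = 1 \<and> c = \<phi> \<or> a = \<phi> \<and> c = 1"
    and "a + c = 1 \<Longrightarrow> a = \<phi> \<and> c = 1 - \<phi> \<or> a = 1 - \<phi> \<and> c = \<phi>"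
proof -
  note g = golden_bounds
  have c1: "c \<le> \<phi>" "\<phi> - 1 \<le> c \<or> c \<le> 1 - \<phi>"
    using c g by (elim insertE emptyE; simp)+
  have "a = 1 \<or> a = \<phi> \<or> a = \<phi> - 1 \<or> a \<le> 1 - \<phi>"
    using a g by (elim insertE emptyE; simp)
  then consider "a = 1" | "a = \<phi>" | "a = \<phi> - 1" | "a \<le> 1 - \<phi>" by blast
  then show "a + c = \<phi> \<Longrightarrow> a = 1 \<and> c = \<phi> - 1 \<or> a = \<phi> - 1 \<and> c = 1"
    "a + c = \<phi> + 1 \<Longrightarrow> a = 1 \<and> c = \<phi> \<or> a = \<phi> \<and> c = 1"
    "a + c = 1 \<Longrightarrow> a = \<phi> \<and> c = 1 - \<phi> \<or> a = 1 - \<phi> \<and> c = \<phi>"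
    by (cases; use c1 g in linarith)+
qed

text \<open>The middle term \<open>c\<close> determines the two terms next to it up to order, and one of them forces the
  outer term on its side to be \<open>0\<close> (for \<open>c = 1\<close> and \<open>c = \<phi>\<close>) or 2 (for \<open>c = \<phi> - 1\<close>).\<close>

lemma no_nonzero_trace_sequence:
  fixes a b c d e :: real
  defines "S \<equiv> {1, -1, \<phi>, -\<phi>, \<phi> - 1, 1 - \<phi>}"
  assumes S: "a \<in> S" "b \<in> S" "d \<in> S" "e \<in> S" and c: "c \<in> {1, \<phi>, \<phi> - 1}"
    and rec: "a + c = \<phi> * b" "b + d = \<phi> * c" "c + e = \<phi> * d"
  shows False
proof -
  note nb = neighbours_in_trace_sequence[folded S_def]
  have S02: "t \<noteq> 0 \<and> t \<noteq> 2" if "t \<in> S" for t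
    using that golden_bounds unfolding S_def by (elim insertE emptyE; simp)
  have g: "\<phi> * (\<phi> - 1) = 1" using golden_sq by (simp add: algebra_simps)
  from c consider "c = 1" | "c = \<phi>" | "c = \<phi> - 1" by blast
  then show False
  proof cases
    case 1
    then have "b + d = \<phi>" using rec(2) by simp
    then have "b = \<phi> - 1 \<or> d = \<phi> - 1" using nb(1)[OF S(2,3)] by blast
    then have "a + c = 1 \<or> c + e = 1" using rec(1,3) g by metis
    then have "a = 0 \<or> e = 0" using 1 by simp
    then show False using S02 S by blast
  next
    case 2
    then have "b + d = \<phi> + 1" using rec(2) golden_sq by simp
    then have "b = 1 \<or> d = 1" using nb(2)[OF S(2,3)] by blast
    then have "a + c = \<phi> \<or> c + e = \<phi>" using rec(1,3) by auto
    then have "a = 0 \<or> e = 0" using 2 by simp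
    then show False using S02 S by blast
  next
    case 3
    then have "b + d = 1" using rec(2) g by simp
    then have "b = \<phi> \<or> d = \<phi>" using nb(3)[OF S(2,3)] by blast
    then have "a + c = \<phi> + 1 \<or> c + e = \<phi> + 1" using rec(1,3) golden_sq by metis
    then have "a = 2 \<or> e = 2" using 3 by auto
    then show False using S02 S by blast
  qed
qed

text \<open>Five consecutive terms are needed: the sequence \<open>0, 1, \<phi>, \<phi>, 1, 0\<close> has a nonzero run of length
  four. The sequence \<open>2, \<phi>, \<phi> - 1, 1 - \<phi>, -\<phi>, -2\<close>, which comes from the powers of \<open>x\<close>
  themselves, never vanishes; this is why \<open>\<plusminus>2\<close> has to be excluded.\<close>

lemma trace_sequence_hits_zero:
  fixes a b c d e :: real
  defines "S \<equiv> {0, 1, -1, \<phi>, -\<phi>, \<phi> - 1, 1 - \<phi>}"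
  assumes S: "a \<in> S" "b \<in> S" "c \<in> S" "d \<in> S" "e \<in> S"
    and rec: "c = \<phi> * b - a" "d = \<phi> * c - b" "e = \<phi> * d - c"
  shows "a = 0 \<or> b = 0 \<or> c = 0 \<or> d = 0 \<or> e = 0"
proof (rule ccontr)
  assume nz: "\<not> ?thesis"
  define S' where "S' = {1, -1, \<phi>, -\<phi>, \<phi> - 1, 1 - \<phi>}"
  have S': "t \<in> S'" "- t \<in> S'" if "t \<in> S" "t \<noteq> 0" for t
    using that unfolding S_def S'_def by auto
  note no = no_nonzero_trace_sequence[folded S'_def]
  have r: "a + c = \<phi> * b" "b + d = \<phi> * c" "c + e = \<phi> * d"
    using rec by simp_all
  have r': "- a + - c = \<phi> * - b" "- b + - d = \<phi> * - c" "- c + - e = \<phi> * - d"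
    by (simp_all only: mult_minus_right minus_add_distrib[symmetric] r)
  have "c \<in> {1, \<phi>, \<phi> - 1} \<or> - c \<in> {1, \<phi>, \<phi> - 1}"
    using S(3) nz unfolding S_def by auto
  then show False
    using no[OF S'(1) S'(1) S'(1) S'(1) _ r] no[OF S'(2) S'(2) S'(2) S'(2) _ r'] S nz by blast
qed

section \<open>Octonion identities\<close>

lemma oct_mult_linear:
  "(x + y) \<bullet>\<^sub>O z = x \<bullet>\<^sub>O z + y \<bullet>\<^sub>O z" "x \<bullet>\<^sub>O (y + z) = x \<bullet>\<^sub>O y + x \<bullet>\<^sub>O z"
  "(c *\<^sub>R x) \<bullet>\<^sub>O z = c *\<^sub>R (x \<bullet>\<^sub>O z)" "x \<bullet>\<^sub>O (c *\<^sub>R z) = c *\<^sub>R (x \<bullet>\<^sub>O z)"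
  "(- x) \<bullet>\<^sub>O z = - (x \<bullet>\<^sub>O z)" "x \<bullet>\<^sub>O (- z) = - (x \<bullet>\<^sub>O z)"
  "(x - y) \<bullet>\<^sub>O z = x \<bullet>\<^sub>O z - y \<bullet>\<^sub>O z" "x \<bullet>\<^sub>O (y - z) = x \<bullet>\<^sub>O y - x \<bullet>\<^sub>O z"
  by (simp_all add: oct_mult_def quat_mult_def quat_cnj_def prod_eq_iff complex_eq_iff algebra_simps)

text \<open>Multiplication by \<open>x\<close> scales the norm by the norm of \<open>x\<close>; polarize in the other factor.\<close>

lemma inner_mult_left: "inner (x \<bullet>\<^sub>O y) (x \<bullet>\<^sub>O z) = inner x x * inner y z"
proof -
  have "oct_N (x \<bullet>\<^sub>O (y + z)) = oct_N x * oct_N (y + z)" by (rule oct_N_mult)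
  then show ?thesis using oct_N_mult[of x y] oct_N_mult[of x z]
    by (simp add: oct_mult_linear oct_N_def inner_add_left inner_add_right inner_commute algebra_simps)
qed

lemma inner_mult_right: "inner (y \<bullet>\<^sub>O x) (z \<bullet>\<^sub>O x) = inner x x * inner y z"
proof -
  have "oct_N ((y + z) \<bullet>\<^sub>O x) = oct_N (y + z) * oct_N x" by (rule oct_N_mult)
  then show ?thesis using oct_N_mult[of y x] oct_N_mult[of z x]
    by (simp add: oct_mult_linear oct_N_def inner_add_left inner_add_right inner_commute algebra_simps)
qed

text \<open>The left alternative law \<open>x (x y) = (x x) y\<close> combined with the quadratic equation of \<open>x\<close>.\<close>

lemma oct_mult_mult_left:
  "x \<bullet>\<^sub>O (x \<bullet>\<^sub>O y) = (2 * inner x oct_one) *\<^sub>R (x \<bullet>\<^sub>O y) - inner x x *\<^sub>R y"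
  by (simp add: oct_mult_def quat_mult_def quat_cnj_def prod_eq_iff complex_eq_iff oct_one_def
     inner_prod_def inner_complex_def algebra_simps power2_eq_square)

lemma inner_mult_cnj: "inner (x \<bullet>\<^sub>O oct_cnj y) oct_one = inner x y"
  by (simp add: oct_mult_def quat_mult_def quat_cnj_def oct_cnj_eq oct_one_def
     inner_prod_def inner_complex_def algebra_simps)

lemma oct_square: "x \<bullet>\<^sub>O x = (2 * inner x oct_one) *\<^sub>R x - inner x x *\<^sub>R oct_one"
  using oct_mult_mult_left[of x oct_one] by (simp add: oct_mult_one_right)

text \<open>Polarize \<open>x\<^sup>2 = - N(x)\<close> on the purely imaginary octonions.\<close>

lemma oct_anticommute:
  assumes "inner x oct_one = 0" "inner y oct_one = 0" "inner x y = 0"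
  shows "y \<bullet>\<^sub>O x = - (x \<bullet>\<^sub>O y)"
  using oct_square[of "x + y"] oct_square[of x] oct_square[of y] assms
  by (simp add: oct_mult_linear inner_add_left inner_add_right inner_commute algebra_simps)
    (metis add_eq_0_iff)



section \<open>Indecomposable sets and subspaces\<close>

lemma indecomposable_subset_subspace:
  assumes ind: "indecomposable T" and ne: "T \<inter> W \<noteq> {}"
    and dich: "\<And>x. x \<in> T \<Longrightarrow> x \<in> W \<or> (\<forall>w\<in>W. orthogonal w x)"
  shows "T \<subseteq> W"
proof (rule ccontr)
  assume "\<not> T \<subseteq> W"
  then have "T - W \<noteq> {}" by blast
  moreover have "T = (T \<inter> W) \<union> (T - W)" by blast
  moreover have "\<forall>a\<in>T \<inter> W. \<forall>b\<in>T - W. orthogonal a b" using dich by blast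
  ultimately have "\<exists>A B. A \<noteq> {} \<and> B \<noteq> {} \<and> T = A \<union> B \<and> (\<forall>a\<in>A. \<forall>b\<in>B. orthogonal a b)"
    using ne by (intro exI[of _ "T \<inter> W"] exI[of _ "T - W"] conjI)
  with ind show False unfolding indecomposable_def by (rule notE)
qed

text \<open>Otherwise the span of \<open>B\<close> would separate \<open>T\<close>, and \<open>T\<close> would have at most the rank of \<open>B\<close>.\<close>

lemma indecomposable_meets_obliquely:
  fixes T :: "'a::euclidean_space set"
  assumes ind: "indecomposable T" and dim: "card B < dim (span T)" and B: "finite B" "b \<in> B" "b \<in> T"
  shows "\<exists>x\<in>T. x \<notin> span B \<and> (\<exists>w\<in>B. inner x w \<noteq> 0)"
proof (rule ccontr)
  assume "\<not> ?thesis"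
  then have h: "x \<in> span B \<or> (\<forall>w\<in>B. orthogonal x w)" if "x \<in> T" for x
    using that unfolding orthogonal_def by blast
  have "T \<subseteq> span B"
  proof (rule indecomposable_subset_subspace[OF ind])
    show "T \<inter> span B \<noteq> {}" using B span_base by blast
    show "x \<in> span B \<or> (\<forall>w\<in>span B. orthogonal w x)" if "x \<in> T" for x
      using h[OF that] orthogonal_to_span[of _ B x] orthogonal_commute by blast
  qed
  then have "dim (span T) \<le> card B"
    using dim_le_card[of T B] B by simp
  then show False using dim by simp
qed

section \<open>Units of an order with finite unit shell\<close>

locale finite_shell_order =
  fixes G :: "octonion set"
  assumes order: "Zphi_order G" and finite_shell: "finite (unit_shell G)"
begin

lemma G_add: "x \<in> G \<Longrightarrow> y \<in> G \<Longrightarrow> x + y \<in> G"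
  and G_scale: "c \<in> Zphi \<Longrightarrow> x \<in> G \<Longrightarrow> c *\<^sub>R x \<in> G"
  and G_mult: "x \<in> G \<Longrightarrow> y \<in> G \<Longrightarrow> x \<bullet>\<^sub>O y \<in> G"
  and G_one: "oct_one \<in> G"
  and G_cnj: "x \<in> G \<Longrightarrow> oct_cnj x \<in> G"
  using order unfolding Zphi_order_def Zphi_submodule_def by (simp_all, (elim conjE, blast)?)

lemma G_minus: "x \<in> G \<Longrightarrow> - x \<in> G"
  using G_scale[of "-1" x] Zphi_closed(2)[of "-1"] by simp

lemma G_diff: "x \<in> G \<Longrightarrow> y \<in> G \<Longrightarrow> x - y \<in> G"
  using G_add[of x "- y"] G_minus by simp

lemma inner_self_Zphi: "x \<in> G \<Longrightarrow> inner x x \<in> Zphi"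
  using order unfolding Zphi_order_def oct_N_def by auto

lemma double_inner_Zphi: "x \<in> G \<Longrightarrow> y \<in> G \<Longrightarrow> 2 * inner x y \<in> Zphi"
  using order unfolding Zphi_order_def Zphi_bilinear_on_def inner_eq_half_oct_B by auto

abbreviation U :: "octonion set" where "U \<equiv> unit_shell G"

lemma U_iff: "x \<in> U \<longleftrightarrow> x \<in> G \<and> inner x x = 1"
  by (simp add: unit_shell_def oct_N_def)

lemma U_one: "oct_one \<in> U"
  using G_one by (simp add: U_iff oct_one_def inner_prod_def inner_complex_def)

lemma U_mult: "x \<in> U \<Longrightarrow> y \<in> U \<Longrightarrow> x \<bullet>\<^sub>O y \<in> U"
  using G_mult inner_mult_left[of x y y] by (simp add: U_iff)

lemma U_minus: "x \<in> U \<Longrightarrow> - x \<in> U"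
  using G_minus by (simp add: U_iff)

lemma U_cnj: "x \<in> U \<Longrightarrow> oct_cnj x \<in> U"
  using G_cnj inner_mult_cnj[of x x] 
  by (simp add: U_iff oct_cnj_eq quat_cnj_def inner_prod_def inner_complex_def)

lemma inner_U_le: "x \<in> U \<Longrightarrow> y \<in> U \<Longrightarrow> \<bar>inner x y\<bar> \<le> 1"
  using Cauchy_Schwarz_ineq2[of x y] by (simp add: U_iff norm_eq_sqrt_inner)

lemma trace_square:
  assumes "u \<in> U"
  shows "2 * inner (u \<bullet>\<^sub>O u) oct_one = (2 * inner u oct_one) * (2 * inner u oct_one) - 2"
  using assms U_one unfolding oct_square by (simp add: U_iff inner_diff_left)

text \<open>Take a unit whose conjugate trace has the largest absolute value \<open>c\<close>. Its square has conjugate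
  trace \<open>c\<^sup>2 - 2\<close>, which exceeds \<open>c\<close> as soon as \<open>c > 2\<close>.\<close>

lemma golden_conj_trace_le:
  assumes "u \<in> U"
  shows "\<bar>golden_conj (2 * inner u oct_one)\<bar> \<le> 2"
proof -
  define c where "c u = \<bar>golden_conj (2 * inner u oct_one)\<bar>" for u
  have "Max (c ` U) \<in> c ` U" using finite_shell U_one by (intro Max_in) auto
  then obtain w where w: "w \<in> U" "c w = Max (c ` U)" by auto
  have "c w \<le> 2"
  proof (rule ccontr)
    assume "\<not> c w \<le> 2"
    then have "2 * c w < c w * c w" by simp
    moreover have "c (w \<bullet>\<^sub>O w) = \<bar>c w * c w - 2\<bar>"
      unfolding c_def trace_square[OF w(1)]
      using golden_conj_chebyshev[of "2 * inner w oct_one"] double_inner_Zphi w(1) U_one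
      by (simp add: U_iff)
    moreover have "c (w \<bullet>\<^sub>O w) \<le> c w" unfolding w(2) using finite_shell U_mult w by (intro Max_ge) auto
    ultimately show False using \<open>\<not> c w \<le> 2\<close> by linarith
  qed
  moreover have "c u \<le> c w" unfolding w(2) using finite_shell assms by (intro Max_ge) auto
  ultimately show ?thesis unfolding c_def by linarith
qed

text \<open>The coefficient of \<open>u\<close> and \<open>v\<close> is the trace of the unit \<open>u v\<^sup>*\<close>, bounded at both real places.\<close>

lemma double_inner_values:
  assumes "u \<in> U" "v \<in> U"
  shows "2 * inner u v \<in> golden_traces"
proof -
  define w where "w = u \<bullet>\<^sub>O oct_cnj v"
  have w: "w \<in> U" unfolding w_def using assms U_mult U_cnj by blast
  have "\<bar>2 * inner w oct_one\<bar> \<le> 2" using inner_U_le[OF w U_one] by simp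
  moreover have "2 * inner w oct_one \<in> Zphi" using w U_one double_inner_Zphi U_iff by blast
  ultimately have "2 * inner w oct_one \<in> golden_traces"
    using golden_conj_trace_le[OF w] Zphi_totally_bounded by blast
  then show ?thesis unfolding w_def inner_mult_cnj .
qed

lemma double_inner_values_distinct:
  assumes "u \<in> U" "v \<in> U" "u \<noteq> v" "u \<noteq> - v"
  shows "2 * inner u v \<in> {0, 1, -1, \<phi>, -\<phi>, \<phi> - 1, 1 - \<phi>}"
proof -
  have "inner u v \<noteq> 1"
  proof
    assume "inner u v = 1"
    then have "inner (u - v) (u - v) = 0" using assms
      by (simp add: U_iff inner_diff_left inner_diff_right inner_commute)
    then show False using assms by simp
  qed
  moreover have "inner u v \<noteq> -1"
  proof
    assume "inner u v = -1"
    then have "inner (u + v) (u + v) = 0" using assms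
      by (simp add: U_iff inner_add_left inner_add_right inner_commute)
    then show False using assms by (simp add: eq_neg_iff_add_eq_0)
  qed
  ultimately show ?thesis using double_inner_values[OF assms(1,2)] by auto
qed

text \<open>A non-integral coefficient is \<open>\<plusminus>\<phi>\<close> or \<open>\<plusminus>(\<phi> - 1)\<close>. In the second case squaring the unit leads to
  the first, as \<open>(\<phi> - 1)\<^sup>2 - 2 = -\<phi>\<close>.\<close>

lemma golden_rotation_exists:
  assumes "non_crystallographic U"
  obtains x where "x \<in> U" "2 * inner x oct_one = \<phi>"
proof -
  obtain \<alpha> \<beta> where ab: "\<alpha> \<in> U" "\<beta> \<in> U" "2 * inner \<alpha> \<beta> \<notin> \<int>"
    using assms unfolding non_crystallographic_def cartan_coeff_def by (auto simp: U_iff)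
  note hyp = that
  define u where "u = \<alpha> \<bullet>\<^sub>O oct_cnj \<beta>"
  have u: "u \<in> U" "2 * inner u oct_one = 2 * inner \<alpha> \<beta>"
    unfolding u_def inner_mult_cnj using ab U_mult U_cnj by auto
  have pos: thesis if "v \<in> U" "2 * inner v oct_one = \<phi> \<or> 2 * inner v oct_one = - \<phi>" for v
    using that hyp[of v] hyp[of "- v"] U_minus by auto
  have "2 * inner u oct_one \<in> golden_traces"
    using double_inner_values[OF u(1) U_one] .
  then have "2 * inner u oct_one = \<phi> \<or> 2 * inner u oct_one = -\<phi> \<or>
     2 * inner u oct_one = \<phi> - 1 \<or> 2 * inner u oct_one = 1 - \<phi>"
    using ab(3) unfolding u(2)[symmetric] by auto
  then show thesis
  proof (elim disjE)
    assume e: "2 * inner u oct_one = \<phi> - 1"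
    have "2 * inner (u \<bullet>\<^sub>O u) oct_one = - \<phi>"
      unfolding trace_square[OF u(1)] e using golden_sq by (simp add: algebra_simps)
    then show thesis using pos U_mult u(1) by blast
  next
    assume e: "2 * inner u oct_one = 1 - \<phi>"
    have "2 * inner (u \<bullet>\<^sub>O u) oct_one = - \<phi>"
      unfolding trace_square[OF u(1)] e using golden_sq by (simp add: algebra_simps)
    then show thesis using pos U_mult u(1) by blast
  qed (use pos u(1) in blast)+
qed

section \<open>An icosian frame\<close>

text \<open>Left multiplication by \<open>x\<close> rotates the plane \<open>span {1, x}\<close> by 36 degrees and preserves the set \<open>D\<close> of
  units that are neither in this plane nor orthogonal to it. Along an orbit in \<open>D\<close> the traces obey
  the recurrence whose sequences reach \<open>0\<close>. The resulting unit is orthogonal to 1, hence not to \<open>x\<close>.\<close>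

lemma perpendicular_unit_exists:
  assumes x: "x \<in> U" "2 * inner x oct_one = \<phi>"
    and y: "y \<in> U" "y \<notin> span {oct_one, x}" "\<exists>w\<in>{oct_one, x}. inner y w \<noteq> 0"
  obtains z where "z \<in> U" "inner z oct_one = 0" "inner z x \<noteq> 0"
proof -
  define D where "D = {z \<in> U. z \<notin> span {oct_one, x} \<and> \<not> (inner z oct_one = 0 \<and> inner z x = 0)}"
  define tr where "tr z = 2 * inner z oct_one" for z
  have xx: "x \<bullet>\<^sub>O x = \<phi> *\<^sub>R x - oct_one" using x by (simp add: oct_square U_iff)
  have xxz: "x \<bullet>\<^sub>O (x \<bullet>\<^sub>O z) = \<phi> *\<^sub>R (x \<bullet>\<^sub>O z) - z" for z
    using x by (simp add: oct_mult_mult_left U_iff)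
  have ix: "inner (x \<bullet>\<^sub>O z) x = inner z oct_one" for z
    using inner_mult_left[of x z oct_one] x by (simp add: oct_mult_one_right U_iff)
  have io: "inner (x \<bullet>\<^sub>O z) oct_one = \<phi> * inner z oct_one - inner z x" for z
    using ix[of "x \<bullet>\<^sub>O z"] unfolding xxz inner_diff_left by (simp add: ix)
  have D_step: "x \<bullet>\<^sub>O z \<in> D" if z: "z \<in> D" for z
  proof -
    have "x \<bullet>\<^sub>O z \<notin> span {oct_one, x}"
    proof
      assume "x \<bullet>\<^sub>O z \<in> span {oct_one, x}"
      then obtain a b where ab: "x \<bullet>\<^sub>O z = a *\<^sub>R oct_one + b *\<^sub>R x"
        unfolding span_insert span_empty by (auto simp: algebra_simps)
      have "z = \<phi> *\<^sub>R (x \<bullet>\<^sub>O z) - x \<bullet>\<^sub>O (x \<bullet>\<^sub>O z)" by (simp add: xxz)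
      also have "\<dots> = \<phi> *\<^sub>R (a *\<^sub>R oct_one + b *\<^sub>R x) - (a *\<^sub>R x + b *\<^sub>R (\<phi> *\<^sub>R x - oct_one))"
        unfolding ab by (simp add: oct_mult_linear oct_mult_one_right xx)
      also have "\<dots> \<in> span {oct_one, x}"
        by (intro span_add span_diff span_scale span_base) auto
      finally show False using z by (simp add: D_def)
    qed
    moreover have "\<not> (inner (x \<bullet>\<^sub>O z) oct_one = 0 \<and> inner (x \<bullet>\<^sub>O z) x = 0)"
      using z unfolding D_def ix io by auto
    ultimately show ?thesis using z x U_mult unfolding D_def by blast
  qed
  \<comment> \<open>A unit of trace \<open>\<plusminus>2\<close> is \<open>\<plusminus>1\<close>, which lies in the plane.\<close>
  have D_values: "tr z \<in> {0, 1, -1, \<phi>, -\<phi>, \<phi> - 1, 1 - \<phi>}" if "z \<in> D" for z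
  proof -
    have "oct_one \<in> span {oct_one, x}" by (simp add: span_base)
    then have "z \<noteq> oct_one" "z \<noteq> - oct_one" using that span_neg unfolding D_def by auto
    then show ?thesis unfolding tr_def using that U_one double_inner_values_distinct unfolding D_def by blast
  qed
  have rec: "tr (x \<bullet>\<^sub>O (x \<bullet>\<^sub>O z)) = \<phi> * tr (x \<bullet>\<^sub>O z) - tr z" for z
    unfolding xxz tr_def by (simp add: inner_diff_left)
  let ?L = "\<lambda>z. x \<bullet>\<^sub>O z"
  have "y \<in> D" using y unfolding D_def by auto
  then have *: "y \<in> D" "?L y \<in> D" "?L (?L y) \<in> D" "?L (?L (?L y)) \<in> D" "?L (?L (?L (?L y))) \<in> D"
    using D_step by blast+
  then have "tr y = 0 \<or> tr (?L y) = 0 \<or> tr (?L (?L y)) = 0 \<or> tr (?L (?L (?L y))) = 0 \<or> tr (?L (?L (?L (?L y)))) = 0"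
    by (intro trace_sequence_hits_zero D_values rec)
  then obtain z where "z \<in> D" "tr z = 0" using * by blast
  then show thesis using that[of z] unfolding D_def tr_def by simp
qed

text \<open>The component \<open>w\<close> of \<open>2 x\<close> orthogonal to 1 and \<open>z\<close> has norm \<open>3 - \<phi> - b\<^sup>2\<close>, where \<open>b\<close> is the
  coefficient of \<open>x\<close> and \<open>z\<close>. Positivity leaves \<open>b = \<plusminus>1\<close> and \<open>b = \<plusminus>(\<phi> - 1)\<close>, for which the norm is
  \<open>(\<phi> - 1)\<^sup>2\<close> and 1. So \<open>\<phi> w\<close> or \<open>w\<close> is again a unit; with \<open>\<plusminus>z\<close> it forms the pair \<open>i\<close>, \<open>j\<close>, and the
  two cases differ in which of them is which.\<close>

lemma icosian_frame_exists:
  assumes x: "x \<in> U" "2 * inner x oct_one = \<phi>"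
    and z: "z \<in> U" "inner z oct_one = 0" "inner z x \<noteq> 0"
  obtains i j where "i \<in> U" "j \<in> U" "inner i oct_one = 0" "inner j oct_one = 0" "inner i j = 0"
    "2 *\<^sub>R x = \<phi> *\<^sub>R oct_one + i + (\<phi> - 1) *\<^sub>R j"
proof -
  define b where "b = 2 * inner z x"
  define w where "w = 2 *\<^sub>R x - \<phi> *\<^sub>R oct_one - b *\<^sub>R z"
  have one: "inner oct_one oct_one = 1" using U_one by (simp add: U_iff)
  have xx: "inner x x = 1" "inner z z = 1" using x z by (simp_all add: U_iff)
  have w1: "inner w oct_one = 0" unfolding w_def using x z one by (simp add: inner_diff_left)
  have wz: "inner w z = 0" unfolding w_def using z(2) xx
    by (simp add: inner_diff_left b_def inner_commute[of x z] inner_commute[of oct_one z])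
  have "inner w w = 2 * inner w x"
    using w1 wz unfolding w_def inner_diff_right[of _ "2 *\<^sub>R x - \<phi> *\<^sub>R oct_one" "b *\<^sub>R z"]
       inner_diff_right[of _ "2 *\<^sub>R x" "\<phi> *\<^sub>R oct_one"] by simp
  also have "\<dots> = 4 - \<phi> * \<phi> - b * b"
    using x xx unfolding w_def by (simp add: inner_diff_left b_def inner_commute[of oct_one] algebra_simps)
  finally have ww: "inner w w = 3 - \<phi> - b * b" using golden_sq by simp
  have b: "b \<in> golden_traces"
    unfolding b_def using double_inner_values z(1) x(1) by blast
  have "b * b \<le> 3 - \<phi>" using ww inner_ge_zero[of w] by linarith
  moreover have "4 > 3 - \<phi>" "\<phi> * \<phi> > 3 - \<phi>" using golden_bounds golden_sq by linarith+
  moreover have "b \<noteq> 0" using z by (simp add: b_def)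
  ultimately consider "b = 1 \<or> b = -1" | "b = \<phi> - 1 \<or> b = 1 - \<phi>" using b by auto
  then show thesis
  proof cases
    case 1
    then have bb: "b * b = 1" by auto
    have "w \<in> G" unfolding w_def using x z G_one 1 Zphi_closed(1) Zphi_closed(2)[of 2] Zphi_closed(2)[of 1] Zphi_closed(2)[of "-1"]
      by (intro G_diff G_scale) (auto simp: U_iff)
    then have "\<phi> *\<^sub>R w \<in> U" using ww bb Zphi_closed(1) golden_sq_inverse
      by (simp add: U_iff G_scale)
    moreover have "b *\<^sub>R z \<in> U" using 1 z(1) U_minus[OF z(1)] by (elim disjE) simp_all
    moreover have "(\<phi> - 1) *\<^sub>R (\<phi> *\<^sub>R w) = w" using golden_sq by (simp add: algebra_simps)
    then have "2 *\<^sub>R x = \<phi> *\<^sub>R oct_one + b *\<^sub>R z + (\<phi> - 1) *\<^sub>R (\<phi> *\<^sub>R w)"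
      by (simp only:) (simp add: w_def)
    moreover have "inner (b *\<^sub>R z) oct_one = 0" "inner (\<phi> *\<^sub>R w) oct_one = 0"
      "inner (b *\<^sub>R z) (\<phi> *\<^sub>R w) = 0"
      using w1 wz z(2) by (simp_all add: inner_commute[of z w])
    ultimately show thesis using that by blast
  next
    case 2
    then have bb: "b * b = 2 - \<phi>" using golden_minus_one_sq by (elim disjE) simp_all
    define j where "j = (if b = \<phi> - 1 then z else - z)"
    have bz: "b *\<^sub>R z = (\<phi> - 1) *\<^sub>R j"
    proof (cases "b = \<phi> - 1")
      case True
      then show ?thesis by (simp add: j_def)
    next
      case False
      then have "b = - (\<phi> - 1)" using 2 by simp
      with False show ?thesis by (simp only: j_def if_False scaleR_minus_left scaleR_minus_right)
    qed
    have "b \<in> Zphi" unfolding b_def using double_inner_Zphi x z U_iff by blast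
    then have "w \<in> G" unfolding w_def using x z G_one Zphi_closed(1) Zphi_closed(2)[of 2]
      by (intro G_diff G_scale) (auto simp: U_iff)
    then have "w \<in> U" using ww bb by (simp add: U_iff)
    moreover have "j \<in> U" "inner j oct_one = 0" "inner w j = 0"
      using z U_minus[OF z(1)] wz by (auto simp: j_def)
    moreover have "2 *\<^sub>R x = \<phi> *\<^sub>R oct_one + w + (\<phi> - 1) *\<^sub>R j" unfolding bz[symmetric] w_def by simp
    ultimately show thesis using that[of w j] w1 by simp
  qed
qed

section \<open>Projection to the quaternion space of the frame\<close>

text \<open>The octonions \<open>1\<close>, \<open>i\<close>, \<open>x\<close>, \<open>p = i x\<close> form a \<open>\<int>[\<phi>]\<close>-basis of the icosian ring, and \<open>v\<close> below is
  the combination of them that projects \<open>\<alpha>\<close>. The coefficients are golden integers because they are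
  values of \<open>2 \<langle>\<alpha>, \<cdot>\<rangle>\<close> on the dual basis \<open>- \<phi> q\<close>, \<open>- \<phi> r\<close>, \<open>\<phi> j\<close>, \<open>\<phi> k\<close>, which again consists of
  elements of the order. So \<open>v\<close> belongs to the order and its norm is a golden integer.\<close>

lemma icosian_dichotomy:
  assumes i: "i \<in> U" "inner i oct_one = 0" and j: "j \<in> U" "inner j oct_one = 0" and ij: "inner i j = 0"
    and x: "x \<in> U" "2 *\<^sub>R x = \<phi> *\<^sub>R oct_one + i + (\<phi> - 1) *\<^sub>R j"
    and \<alpha>: "\<alpha> \<in> U"
  shows "\<alpha> \<in> span {oct_one, i, j, i \<bullet>\<^sub>O j} \<or> (\<forall>w\<in>{oct_one, i, j, i \<bullet>\<^sub>O j}. inner \<alpha> w = 0)"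
proof -
  define k where "k = i \<bullet>\<^sub>O j"
  have inG: "oct_one \<in> G" "i \<in> G" "j \<in> G" "x \<in> G" "\<alpha> \<in> G" using i j x \<alpha> G_one by (simp_all add: U_iff)
  have one: "inner oct_one oct_one = 1" using U_one by (simp add: U_iff)
  have k: "k \<in> U" unfolding k_def using U_mult i j by blast
  have unit: "inner i i = 1" "inner j j = 1" "inner k k = 1" using i j k by (simp_all add: U_iff)
  have ii: "i \<bullet>\<^sub>O i = - oct_one" "j \<bullet>\<^sub>O j = - oct_one" "i \<bullet>\<^sub>O k = - j"
    using i j unit by (simp_all add: oct_square k_def oct_mult_mult_left)
  have ji: "j \<bullet>\<^sub>O i = - k" unfolding k_def by (rule oct_anticommute[OF i(2) j(2) ij])
  have k_perp: "inner k i = 0" "inner k j = 0" "inner k oct_one = 0"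
    using inner_mult_left[of i j oct_one] inner_mult_right[of i j oct_one] inner_mult_left[of i k oct_one]
      unit i j ij
    by (simp_all add: k_def[symmetric] ii oct_mult_one_left oct_mult_one_right inner_commute)
  note perp = i(2) j(2) ij k_perp i(2)[unfolded inner_commute[of i]] j(2)[unfolded inner_commute[of j]]
    ij[unfolded inner_commute[of i]] k_perp[unfolded inner_commute[of k]]
  \<comment> \<open>In the frame, \<open>(\<phi> - 1) / 2\<close> is \<open>1 / (2 \<phi>)\<close>: these are the usual coordinates of an icosian.\<close>
  have xe: "x = (\<phi> / 2) *\<^sub>R oct_one + (1 / 2) *\<^sub>R i + ((\<phi> - 1) / 2) *\<^sub>R j"
  proof -
    have "x = (1 / 2) *\<^sub>R (2 *\<^sub>R x)" by simp
    then show ?thesis unfolding x(2) by (simp add: scaleR_add_right)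
  qed
  define p q r where "p = i \<bullet>\<^sub>O x" and "q = j \<bullet>\<^sub>O x" and "r = i \<bullet>\<^sub>O q"
  have p: "p = (\<phi> / 2) *\<^sub>R i - (1 / 2) *\<^sub>R oct_one + ((\<phi> - 1) / 2) *\<^sub>R k"
    unfolding p_def xe by (simp add: oct_mult_linear oct_mult_one_right ii k_def[symmetric])
  have q: "q = (\<phi> / 2) *\<^sub>R j - (1 / 2) *\<^sub>R k - ((\<phi> - 1) / 2) *\<^sub>R oct_one"
    unfolding q_def xe by (simp add: oct_mult_linear oct_mult_one_right ii ji)
  have r: "r = (\<phi> / 2) *\<^sub>R k + (1 / 2) *\<^sub>R j - ((\<phi> - 1) / 2) *\<^sub>R i"
    unfolding r_def q by (simp add: oct_mult_linear oct_mult_one_right ii k_def[symmetric])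
  have pqrG: "p \<in> G" "q \<in> G" "r \<in> G" "k \<in> G"
    unfolding p_def q_def r_def using inG k G_mult by (auto simp: U_iff)
  define s where "s n = 2 * inner \<alpha> ([oct_one, i, j, k] ! n)" for n
  have s: "inner \<alpha> oct_one = s 0 / 2" "inner \<alpha> i = s 1 / 2" "inner \<alpha> j = s 2 / 2" "inner \<alpha> k = s 3 / 2"
    by (simp_all add: s_def)
  define v where "v = (- \<phi> * (2 * inner \<alpha> q)) *\<^sub>R oct_one + (- \<phi> * (2 * inner \<alpha> r)) *\<^sub>R i
     + (\<phi> * (2 * inner \<alpha> j)) *\<^sub>R x + (\<phi> * (2 * inner \<alpha> k)) *\<^sub>R p"
  have vG: "v \<in> G" unfolding v_def using inG pqrG
    by (intro G_add G_scale Zphi_closed(1,3,4) double_inner_Zphi)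
  have aq: "2 * inner \<alpha> q = (\<phi> * s 2 - s 3 - (\<phi> - 1) * s 0) / 2"
    unfolding q by (simp add: inner_diff_right inner_add_right s field_simps)
  have ar: "2 * inner \<alpha> r = (\<phi> * s 3 + s 2 - (\<phi> - 1) * s 1) / 2"
    unfolding r by (simp add: inner_diff_right inner_add_right s field_simps)
  \<comment> \<open>This identifies \<open>v\<close> with the orthogonal projection, since \<open>1, i, j, k\<close> is orthonormal.\<close>
  have ve: "v = (s 0 / 2) *\<^sub>R oct_one + (s 1 / 2) *\<^sub>R i + (s 2 / 2) *\<^sub>R j + (s 3 / 2) *\<^sub>R k"
  proof -
    have "v = (- \<phi> * (2 * inner \<alpha> q) + \<phi> * s 2 * (\<phi> / 2) - \<phi> * s 3 * (1 / 2)) *\<^sub>R oct_one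
       + (- \<phi> * (2 * inner \<alpha> r) + \<phi> * s 2 * (1 / 2) + \<phi> * s 3 * (\<phi> / 2)) *\<^sub>R i
       + (\<phi> * s 2 * ((\<phi> - 1) / 2)) *\<^sub>R j + (\<phi> * s 3 * ((\<phi> - 1) / 2)) *\<^sub>R k"
      unfolding v_def s by (subst xe, subst p) (simp add: algebra_simps)
    moreover have "- \<phi> * (2 * inner \<alpha> q) + \<phi> * s 2 * (\<phi> / 2) - \<phi> * s 3 * (1 / 2) = s 0 / 2"
      unfolding aq using golden_sq by (simp add: field_simps) algebra
    moreover have "- \<phi> * (2 * inner \<alpha> r) + \<phi> * s 2 * (1 / 2) + \<phi> * s 3 * (\<phi> / 2) = s 1 / 2"
      unfolding ar using golden_sq by (simp add: field_simps) algebra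
    moreover have "\<phi> * t * ((\<phi> - 1) / 2) = t / 2" for t
      using golden_sq by (simp add: field_simps) algebra
    ultimately show ?thesis by (simp only:)
  qed
  have \<alpha>v: "inner \<alpha> v = inner v v"
    unfolding ve by (simp add: inner_add_left inner_add_right s one unit perp field_simps)
  have vv: "inner v v = (\<Sum>n<4. s n * s n) / 4"
    unfolding ve by (simp add: inner_add_left inner_add_right one unit perp field_simps numeral_eq_Suc)
  have rest: "inner (\<alpha> - v) (\<alpha> - v) = 1 - inner v v"
    using \<alpha> \<alpha>v by (simp add: U_iff inner_diff_left inner_diff_right inner_commute)
  show ?thesis
  proof (cases "inner v v < 1")
    case False
    then have "\<alpha> = v" using rest inner_ge_zero[of "\<alpha> - v"] by simp
    moreover have "v \<in> span {oct_one, i, j, k}"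
      unfolding ve by (intro span_add span_scale span_base) auto
    ultimately show ?thesis unfolding k_def by simp
  next
    case True
    have "s n \<in> golden_traces" if "n < 4" for n
    proof -
      have "[oct_one, i, j, k] ! n \<in> set [oct_one, i, j, k]" using that by (intro nth_mem) simp
      then have "[oct_one, i, j, k] ! n \<in> U" using U_one i j k by auto
      then show ?thesis unfolding s_def by (rule double_inner_values[OF \<alpha>])
    qed
    then have "inner v v = 0 \<or> inner v v = 2 - \<phi>"
      using sum_four_trace_squares[of s] inner_self_Zphi[OF vG] True unfolding vv by blast
    then show ?thesis
    proof
      assume "inner v v = 0"
      then have v0: "inner v w = 0" for w by simp
      show ?thesis using v0[of oct_one] v0[of i] v0[of j] v0[of k]
        unfolding ve k_def[symmetric] by (simp add: inner_add_left s one unit perp)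
    next
      assume n: "inner v v = 2 - \<phi>"
      then have "\<phi> *\<^sub>R v \<in> U" using vG Zphi_closed(1) golden_sq_inverse
        by (simp add: U_iff G_scale)
      then have "2 * inner \<alpha> (\<phi> *\<^sub>R v) \<in> golden_traces"
        using double_inner_values[OF \<alpha>] by blast
      moreover have "2 * inner \<alpha> (\<phi> *\<^sub>R v) = 2 * (\<phi> - 1)"
        unfolding inner_scaleR_right \<alpha>v n using golden_sq by (simp add: algebra_simps)
      moreover have "2 * (\<phi> - 1) \<notin> golden_traces" using golden_bounds by auto
      ultimately show ?thesis by metis
    qed
  qed
qed

end

section \<open>Nonexistence in rank eight\<close>

theorem corollary6p2:
  "\<not> (\<exists>G :: octonion set.
        Zphi_order G \<and>
        root_shell_system (unit_shell G) \<and>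
        indecomposable (unit_shell G) \<and>
        non_crystallographic (unit_shell G) \<and>
        dim (span (unit_shell G)) = 8)"
proof
  assume "\<exists>G :: octonion set.
        Zphi_order G \<and>
        root_shell_system (unit_shell G) \<and>
        indecomposable (unit_shell G) \<and>
        non_crystallographic (unit_shell G) \<and>
        dim (span (unit_shell G)) = 8"
  then obtain G :: "octonion set" where order: "Zphi_order G" and root: "root_shell_system (unit_shell G)"
    and ind: "indecomposable (unit_shell G)" and nc: "non_crystallographic (unit_shell G)"
    and dim: "dim (span (unit_shell G)) = 8" by blast
  interpret finite_shell_order G
    using order root by unfold_locales (simp_all add: root_shell_system_def)
  obtain x where x: "x \<in> U" "2 * inner x oct_one = \<phi>" using golden_rotation_exists[OF nc] .
  have "card {oct_one, x} \<le> 2" using card_length[of "[oct_one, x]"] by simp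
  then have "card {oct_one, x} < dim (span U)" using dim by simp
  then obtain y where "y \<in> U" "y \<notin> span {oct_one, x}" "\<exists>w\<in>{oct_one, x}. inner y w \<noteq> 0"
    using indecomposable_meets_obliquely[OF ind, of "{oct_one, x}" oct_one] U_one by auto
  then obtain z where z: "z \<in> U" "inner z oct_one = 0" "inner z x \<noteq> 0"
    using perpendicular_unit_exists[OF x] by blast
  obtain i j where ij: "i \<in> U" "j \<in> U" "inner i oct_one = 0" "inner j oct_one = 0" "inner i j = 0"
    "2 *\<^sub>R x = \<phi> *\<^sub>R oct_one + i + (\<phi> - 1) *\<^sub>R j"
    using icosian_frame_exists[OF x z] .
  let ?H = "{oct_one, i, j, i \<bullet>\<^sub>O j}"
  have "card ?H \<le> 4" using card_length[of "[oct_one, i, j, i \<bullet>\<^sub>O j]"] by simp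
  then have "card ?H < dim (span U)" using dim by simp
  then obtain \<alpha> where "\<alpha> \<in> U" "\<alpha> \<notin> span ?H" "\<exists>w\<in>?H. inner \<alpha> w \<noteq> 0"
    using indecomposable_meets_obliquely[OF ind, of ?H oct_one] U_one by blast
  then show False
    using icosian_dichotomy[OF ij(1,3,2,4,5) x(1) ij(6)] by blast
qed

end
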